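(* Let $X$ be an arbitrary Hilbert space (as a matter of fact, the result is valid for any Banach space $X$), and equip $cabv(X)$ with the variational norm. Let $M\geq 1$, $\omega_1,\dots,\omega_M\in Lip(T)$ and $R_1,\dots,R_M\in\mathcal{L}(X)$; let $H:cabv(X)\to cabv(X)$ be given by $H(\mu)=\sum_{i=1}^{M}R_i\circ\omega_i(\mu)$. Let $\mu^0\in cabv(X)$. Assume: (a) $e=\sum_{i=1}^{M}\|R_i\|_o<1$; (b) $\emptyset\neq A\subseteq cabv(X)$ is a closed set such that $H(\mu)+\mu^0\in A$ for any $\mu\in A$. (In particular, one can take $A=cabv(X)$, or one can take $A=B_a(X)$ if $0<a<\infty$ and $\|\mu^0\|+a\sum_{i=1}^{M}\|R_i\|_o\leq a$.) Under these hypotheses, define $H_2:A\to A$ via $H_2(\mu)=H(\mu)+\mu^0$ for any $\mu\in A$. Then $H_2$ is a contraction with contraction factor $\leq e$ (for the metric given by the variational norm). Moreover: (i) if $\mu^0=0$, then $0\in A$; (ii) there exists a unique $\mu^{\ast}\in A$ such that $H_2(\mu^{\ast})=\mu^{\ast}$; in case $\mu^0=0$, we have $\mu^{\ast}=0$.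
   Context: All vector spaces are non-null and over $K=\mathbb{R}$ or $\mathbb{C}$. $(T,d)$ is a compact metric space with at least two elements, $\mathcal{B}$ its Borel $\sigma$-algebra. $Lip(T)$ is the set of Lipschitz maps $T\to T$. A contraction is a Lipschitz self-map of a metric space with Lipschitz constant $<1$; this constant is its contraction factor. $\mathcal{L}(X)$ is the space of continuous linear operators on $X$, with operator norm $\|\cdot\|_o$. $cabv(X)$ is the Banach space of $\sigma$-additive $\mu:\mathcal{B}\to X$ with finite total variation, with the variational norm $\|\mu\|=|\mu|(T)=\sup\sum_i\|\mu(A_i)\|$ (supremum over finite Borel partitions $(A_i)$ of $T$). For continuous $h:T\to T$, $h(\mu)(B)=\mu(h^{-1}(B))$ for $B\in\mathcal{B}$; for $R\in\mathcal{L}(X)$, $(R\circ h(\mu))(B)=R(\mu(h^{-1}(B)))$. $B_a(X)=\{\mu\in cabv(X):\|\mu\|\leq a\}$. *)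

theory Defs
  imports "HOL-Analysis.Analysis"
begin

text \<open>
  A normed space over \<open>K = \<real>\<close> or \<open>K = \<complex>\<close> is a real normed space \<open>'x\<close> whose real scalar
  multiplication extends to a homogeneous action of \<open>K\<close>. The types \<^typ>\<open>real\<close> and
  \<^typ>\<open>complex\<close> are instances of \<^class>\<open>real_normed_field\<close>, and by the theorems of Gelfand
  and Mazur they are the only ones up to isometric isomorphism.
\<close>

locale normed_space_over = vector_space scale
  for scale :: "'k::real_normed_field \<Rightarrow> 'x::real_normed_vector \<Rightarrow> 'x" +
  assumes scale_of_real: "scale (of_real r) x = r *\<^sub>R x"
    and norm_scale: "norm (scale c x) = norm c * norm x"

lemma normed_space_over_real: "normed_space_over (scaleR :: real \<Rightarrow> 'x::real_normed_vector \<Rightarrow> 'x)"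
  by unfold_locales (simp_all add: algebra_simps)

lemma normed_space_over_complex: "normed_space_over ((*) :: complex \<Rightarrow> complex \<Rightarrow> complex)"
  by unfold_locales (simp_all add: algebra_simps scaleR_conv_of_real norm_mult)

text \<open>For a singleton \<open>A\<close> the Lipschitz constant is \<open>0\<close>, as \<^const>\<open>lipschitz_on\<close> requires
  nonnegative constants.\<close>

definition lipschitz_const :: "'a::metric_space set \<Rightarrow> ('a \<Rightarrow> 'b::metric_space) \<Rightarrow> real" where
  "lipschitz_const A f = Inf {L. L-lipschitz_on A f}"

definition contraction_on :: "'a::metric_space set \<Rightarrow> ('a \<Rightarrow> 'a) \<Rightarrow> bool" where
  "contraction_on A f \<longleftrightarrow>
     f ` A \<subseteq> A \<and> (\<exists>L. L-lipschitz_on A f) \<and> lipschitz_const A f < 1"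

definition closed_invariant :: "('a::topological_space \<Rightarrow> 'a) \<Rightarrow> 'a set \<Rightarrow> bool" where
  "closed_invariant f A \<longleftrightarrow> A \<noteq> {} \<and> closed A \<and> (\<forall>x\<in>A. f x \<in> A)"

definition borel_partitions :: "'t::topological_space set set set" where
  "borel_partitions = {P. finite P \<and> P \<subseteq> sets borel \<and> partition_on UNIV P}"

definition partition_sums :: "('t::topological_space set \<Rightarrow> 'x::real_normed_vector) \<Rightarrow> real set" where
  "partition_sums \<mu> = (\<lambda>P. \<Sum>B\<in>P. norm (\<mu> B)) ` borel_partitions"

text \<open>This real-valued supremum is meaningful only if the sums are bounded, as they are in the
  type below.\<close>

definition total_variation :: "('t::topological_space set \<Rightarrow> 'x::real_normed_vector) \<Rightarrow> real" where
  "total_variation \<mu> = Sup (partition_sums \<mu>)"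

definition is_cabv :: "('t::topological_space set \<Rightarrow> 'x::real_normed_vector) \<Rightarrow> bool" where
  "is_cabv \<mu> \<longleftrightarrow>
     (\<forall>B. B \<notin> sets borel \<longrightarrow> \<mu> B = 0) \<and>
     (\<forall>B :: nat \<Rightarrow> 't set. range B \<subseteq> sets borel \<longrightarrow> disjoint_family B \<longrightarrow>
        (\<lambda>n. \<mu> (B n)) sums \<mu> (\<Union>n. B n)) \<and>
     bdd_above (partition_sums \<mu>)"

lemma is_cabv_outside: "is_cabv \<mu> \<Longrightarrow> B \<notin> sets borel \<Longrightarrow> \<mu> B = 0"
  by (simp add: is_cabv_def)

lemma is_cabv_sums:
  fixes B :: "nat \<Rightarrow> 't::topological_space set"
  shows "is_cabv \<mu> \<Longrightarrow> range B \<subseteq> sets borel \<Longrightarrow> disjoint_family B \<Longrightarrow>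
    (\<lambda>n. \<mu> (B n)) sums \<mu> (\<Union>n. B n)"
  by (simp add: is_cabv_def)

lemma is_cabv_bdd: "is_cabv \<mu> \<Longrightarrow> bdd_above (partition_sums \<mu>)"
  by (simp add: is_cabv_def)

lemma is_cabvI:
  fixes \<mu> :: "'t::topological_space set \<Rightarrow> 'x::real_normed_vector"
  assumes "\<And>B. B \<notin> sets borel \<Longrightarrow> \<mu> B = 0"
    and "\<And>B :: nat \<Rightarrow> 't set. range B \<subseteq> sets borel \<Longrightarrow> disjoint_family B \<Longrightarrow>
      (\<lambda>n. \<mu> (B n)) sums \<mu> (\<Union>n. B n)"
    and "\<And>P. P \<in> borel_partitions \<Longrightarrow> (\<Sum>B\<in>P. norm (\<mu> B)) \<le> c"
  shows "is_cabv \<mu>"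
  using assms unfolding is_cabv_def partition_sums_def by (auto intro!: bdd_aboveI2)

lemma is_cabv_empty:
  fixes \<mu> :: "'t::topological_space set \<Rightarrow> 'x::real_normed_vector"
  assumes "is_cabv \<mu>"
  shows "\<mu> {} = 0"
proof -
  have "(\<lambda>n::nat. \<mu> {}) sums \<mu> (\<Union>n::nat. {})"
    by (rule is_cabv_sums[OF assms]) (auto simp: disjoint_family_on_def)
  then show ?thesis
    using sums_summable summable_const_iff by blast
qed

lemma trivial_borel_partition: "{UNIV} \<in> (borel_partitions :: 't::topological_space set set set)"
  by (auto simp: borel_partitions_def partition_on_def disjoint_def)

lemma partition_sums_nonempty: "partition_sums \<mu> \<noteq> {}"
  using trivial_borel_partition by (auto simp: partition_sums_def)

lemma partition_sum_le_total_variation: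
  "is_cabv \<mu> \<Longrightarrow> P \<in> borel_partitions \<Longrightarrow> (\<Sum>B\<in>P. norm (\<mu> B)) \<le> total_variation \<mu>"
  unfolding total_variation_def
  by (rule cSup_upper) (auto simp: partition_sums_def dest: is_cabv_bdd)

lemma total_variation_le:
  assumes "\<And>P. P \<in> borel_partitions \<Longrightarrow> (\<Sum>B\<in>P. norm (\<mu> B)) \<le> c"
  shows "total_variation \<mu> \<le> c"
  unfolding total_variation_def
  by (rule cSup_least[OF partition_sums_nonempty]) (auto simp: partition_sums_def assms)

lemma total_variation_nonneg: "is_cabv \<mu> \<Longrightarrow> 0 \<le> total_variation \<mu>"
  using partition_sum_le_total_variation[OF _ trivial_borel_partition, of \<mu>]
  by (auto intro: order_trans[OF norm_ge_zero])

lemma norm_le_total_variation: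
  fixes \<mu> :: "'t::topological_space set \<Rightarrow> 'x::real_normed_vector"
  assumes "is_cabv \<mu>"
  shows "norm (\<mu> B) \<le> total_variation \<mu>"
proof (cases "B \<in> sets borel \<and> B \<noteq> {} \<and> B \<noteq> UNIV")
  case True
  then have "{B, - B} \<in> borel_partitions"
    by (auto simp: borel_partitions_def partition_on_def disjoint_def)
  from partition_sum_le_total_variation[OF assms this] True
  have "norm (\<mu> B) + norm (\<mu> (- B)) \<le> total_variation \<mu>"
    by (subst (asm) sum.insert) auto
  then show ?thesis
    using norm_ge_zero[of "\<mu> (- B)"] by linarith
next
  case False
  then consider "B \<notin> sets borel" | "B = {}" | "B = UNIV" by blast
  then show ?thesis
  proof cases
    case 3
    then show ?thesis
      using partition_sum_le_total_variation[OF assms trivial_borel_partition] by simp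
  qed (use assms in \<open>auto simp: is_cabv_outside is_cabv_empty total_variation_nonneg\<close>)
qed

lemma is_cabv_zero: "is_cabv (\<lambda>B. 0)"
  by (rule is_cabvI[where c = 0]) auto

lemma is_cabv_add:
  assumes "is_cabv \<mu>" "is_cabv \<nu>"
  shows "is_cabv (\<lambda>B. \<mu> B + \<nu> B)"
    and "total_variation (\<lambda>B. \<mu> B + \<nu> B) \<le> total_variation \<mu> + total_variation \<nu>"
proof -
  have *: "(\<Sum>B\<in>P. norm (\<mu> B + \<nu> B)) \<le> total_variation \<mu> + total_variation \<nu>"
    if "P \<in> borel_partitions" for P
  proof -
    have "(\<Sum>B\<in>P. norm (\<mu> B + \<nu> B)) \<le> (\<Sum>B\<in>P. norm (\<mu> B) + norm (\<nu> B))"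
      by (rule sum_mono) (rule norm_triangle_ineq)
    also have "\<dots> \<le> total_variation \<mu> + total_variation \<nu>"
      unfolding sum.distrib
      by (intro add_mono partition_sum_le_total_variation assms that)
    finally show ?thesis .
  qed
  show "is_cabv (\<lambda>B. \<mu> B + \<nu> B)"
    by (rule is_cabvI[OF _ _ *])
      (simp_all add: is_cabv_outside[OF assms(1)] is_cabv_outside[OF assms(2)]
        sums_add[OF is_cabv_sums[OF assms(1)] is_cabv_sums[OF assms(2)]])
  show "total_variation (\<lambda>B. \<mu> B + \<nu> B) \<le> total_variation \<mu> + total_variation \<nu>"
    by (rule total_variation_le) (rule *)
qed

lemma is_cabv_compose:
  assumes "is_cabv \<mu>" "bounded_linear f"
  shows "is_cabv (\<lambda>B. f (\<mu> B))"
proof (rule is_cabvI)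
  fix P :: "'a set set" assume P: "P \<in> borel_partitions"
  have "(\<Sum>B\<in>P. norm (f (\<mu> B))) \<le> (\<Sum>B\<in>P. onorm f * norm (\<mu> B))"
    by (rule sum_mono) (rule onorm[OF assms(2)])
  also have "\<dots> \<le> onorm f * total_variation \<mu>"
    unfolding sum_distrib_left[symmetric]
    by (intro mult_left_mono partition_sum_le_total_variation assms P onorm_pos_le)
  finally show "(\<Sum>B\<in>P. norm (f (\<mu> B))) \<le> onorm f * total_variation \<mu>" .
next
  show "f (\<mu> B) = 0" if "B \<notin> sets borel" for B
    using is_cabv_outside[OF assms(1) that] linear_simps(3)[OF assms(2)] by simp
  show "(\<lambda>n. f (\<mu> (B n))) sums f (\<mu> (\<Union>n. B n))"
    if "range B \<subseteq> sets borel" "disjoint_family B" for B :: "nat \<Rightarrow> 'a set"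
    by (rule bounded_linear.sums[OF assms(2) is_cabv_sums[OF assms(1) that]])
qed

lemma is_cabv_image:
  fixes \<mu> :: "'t::topological_space set \<Rightarrow> 'x::real_normed_vector" and h :: "'t \<Rightarrow> 't"
  assumes \<mu>: "is_cabv \<mu>" and h: "h \<in> borel \<rightarrow>\<^sub>M borel"
  shows "is_cabv (\<lambda>B. if B \<in> sets borel then \<mu> (h -` B) else 0)"
proof (rule is_cabvI)
  have vimage: "h -` B \<in> sets borel" if "B \<in> sets borel" for B
    using measurable_sets[OF h that] by simp
  fix B :: "nat \<Rightarrow> 't set"
  assume B: "range B \<subseteq> sets borel" "disjoint_family B"
  have "(\<lambda>n. \<mu> (h -` B n)) sums \<mu> (\<Union>n. h -` B n)"
    using B by (intro is_cabv_sums[OF \<mu>]) (auto simp: disjoint_family_on_def intro!: vimage)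
  moreover have "(\<Union>n. B n) \<in> sets borel"
    using B(1) by blast
  ultimately show "(\<lambda>n. if B n \<in> sets borel then \<mu> (h -` B n) else 0) sums
      (if (\<Union>n. B n) \<in> sets borel then \<mu> (h -` (\<Union>n. B n)) else 0)"
    using B(1) by (simp add: vimage_UN range_subsetD)
next
  fix P :: "'t set set" assume P: "P \<in> borel_partitions"
  define Q where "Q = {B \<in> P. h -` B \<noteq> {}}"
  have fin: "finite P" and sub: "P \<subseteq> sets borel" and part: "partition_on UNIV P"
    using P by (auto simp: borel_partitions_def)
  have inj: "inj_on (vimage h) Q"
  proof (rule inj_onI)
    fix A B assume AB: "A \<in> Q" "B \<in> Q" "h -` A = h -` B"
    then obtain x where "h x \<in> A" "h x \<in> B"
      by (auto simp: Q_def)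
    moreover have "A \<in> P" "B \<in> P" "disjoint P"
      using AB part by (simp_all add: Q_def partition_on_def)
    ultimately show "A = B"
      unfolding disjoint_def by blast
  qed
  have "vimage h ` Q \<in> borel_partitions"
    unfolding borel_partitions_def mem_Collect_eq partition_on_def
  proof (intro conjI)
    show "finite (vimage h ` Q)"
      using fin by (simp add: Q_def)
    show "vimage h ` Q \<subseteq> sets borel"
      using sub measurable_sets[OF h] by (auto simp: Q_def)
    show "\<Union> (vimage h ` Q) = UNIV"
      using part by (fastforce simp: Q_def partition_on_def)
    show "disjoint (vimage h ` Q)"
      using part by (fastforce simp: Q_def partition_on_def disjoint_def)
    show "{} \<notin> vimage h ` Q"
      by (auto simp: Q_def)
  qed
  from partition_sum_le_total_variation[OF \<mu> this]
  have "(\<Sum>B\<in>Q. norm (\<mu> (h -` B))) \<le> total_variation \<mu>"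
    by (simp add: sum.reindex[OF inj])
  also have "(\<Sum>B\<in>Q. norm (\<mu> (h -` B))) =
      (\<Sum>B\<in>P. norm (if B \<in> sets borel then \<mu> (h -` B) else 0))"
    using sub by (intro sum.mono_neutral_cong_left) (auto simp: Q_def fin is_cabv_empty[OF \<mu>])
  finally show "(\<Sum>B\<in>P. norm (if B \<in> sets borel then \<mu> (h -` B) else 0)) \<le> total_variation \<mu>" .
qed auto

text \<open>
  A measure \<open>\<B> \<rightarrow> X\<close> is represented by its extension by \<open>0\<close> to all subsets of \<open>T\<close>, so that
  equality in the type is equality on Borel sets.
\<close>

typedef (overloaded) ('t, 'x) cabv =
    "{\<mu> :: 't::topological_space set \<Rightarrow> 'x::real_normed_vector. is_cabv \<mu>}"
  morphisms measure_of_cabv Cabv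
  using is_cabv_zero by blast

setup_lifting type_definition_cabv

lemma cabv_eqI:
  assumes "\<And>B. B \<in> sets borel \<Longrightarrow> measure_of_cabv \<mu> B = measure_of_cabv \<nu> B"
  shows "\<mu> = \<nu>"
proof -
  have "measure_of_cabv \<mu> B = measure_of_cabv \<nu> B" for B
    using assms[of B] is_cabv_outside[OF measure_of_cabv[of \<mu>, simplified], of B]
      is_cabv_outside[OF measure_of_cabv[of \<nu>, simplified], of B] by metis
  then show ?thesis
    by (simp add: measure_of_cabv_inject[symmetric] fun_eq_iff)
qed

instantiation cabv :: (topological_space, real_normed_vector) real_normed_vector
begin

lift_definition zero_cabv :: "('a, 'b) cabv" is "\<lambda>B. 0"
  by (rule is_cabv_zero)

lift_definition plus_cabv :: "('a, 'b) cabv \<Rightarrow> ('a, 'b) cabv \<Rightarrow> ('a, 'b) cabv"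
  is "\<lambda>\<mu> \<nu> B. \<mu> B + \<nu> B"
  by (rule is_cabv_add)

lift_definition scaleR_cabv :: "real \<Rightarrow> ('a, 'b) cabv \<Rightarrow> ('a, 'b) cabv"
  is "\<lambda>r \<mu> B. r *\<^sub>R \<mu> B"
  by (rule is_cabv_compose[OF _ bounded_linear_scaleR_right])

lift_definition uminus_cabv :: "('a, 'b) cabv \<Rightarrow> ('a, 'b) cabv" is "\<lambda>\<mu> B. - \<mu> B"
  by (rule is_cabv_compose[OF _ bounded_linear_minus[OF bounded_linear_ident]])

lift_definition minus_cabv :: "('a, 'b) cabv \<Rightarrow> ('a, 'b) cabv \<Rightarrow> ('a, 'b) cabv"
  is "\<lambda>\<mu> \<nu> B. \<mu> B - \<nu> B"
proof -
  fix \<mu> \<nu> :: "'a set \<Rightarrow> 'b" assume \<mu>: "is_cabv \<mu>" and \<nu>: "is_cabv \<nu>"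
  have "is_cabv (\<lambda>B. \<mu> B + - \<nu> B)"
    by (rule is_cabv_add(1)[OF \<mu> is_cabv_compose[OF \<nu> bounded_linear_minus[OF bounded_linear_ident]]])
  then show "is_cabv (\<lambda>B. \<mu> B - \<nu> B)"
    by simp
qed

lift_definition norm_cabv :: "('a, 'b) cabv \<Rightarrow> real" is total_variation .

definition dist_cabv :: "('a, 'b) cabv \<Rightarrow> ('a, 'b) cabv \<Rightarrow> real" where
  "dist_cabv \<mu> \<nu> = norm (\<mu> - \<nu>)"

definition sgn_cabv :: "('a, 'b) cabv \<Rightarrow> ('a, 'b) cabv" where
  "sgn_cabv \<mu> = scaleR (inverse (norm \<mu>)) \<mu>"

definition uniformity_cabv :: "(('a, 'b) cabv \<times> ('a, 'b) cabv) filter" where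
  "uniformity_cabv = (INF e\<in>{0 <..}. principal {(\<mu>, \<nu>). dist \<mu> \<nu> < e})"

definition open_cabv :: "('a, 'b) cabv set \<Rightarrow> bool" where
  "open_cabv S = (\<forall>\<mu>\<in>S. \<forall>\<^sub>F (\<mu>', \<nu>) in uniformity. \<mu>' = \<mu> \<longrightarrow> \<nu> \<in> S)"

instance
proof
  fix \<mu> \<nu> \<rho> :: "('a, 'b) cabv" and r s :: real
  show "\<mu> + \<nu> + \<rho> = \<mu> + (\<nu> + \<rho>)"
    by transfer (simp add: add.assoc)
  show "\<mu> + \<nu> = \<nu> + \<mu>"
    by transfer (simp add: add.commute)
  show "0 + \<mu> = \<mu>"
    by transfer simp
  show "- \<mu> + \<mu> = 0"
    by transfer simp
  show "\<mu> - \<nu> = \<mu> + - \<nu>"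
    by transfer simp
  show "r *\<^sub>R (\<mu> + \<nu>) = r *\<^sub>R \<mu> + r *\<^sub>R \<nu>"
    by transfer (simp add: scaleR_add_right)
  show "(r + s) *\<^sub>R \<mu> = r *\<^sub>R \<mu> + s *\<^sub>R \<mu>"
    by transfer (simp add: scaleR_add_left)
  show "r *\<^sub>R s *\<^sub>R \<mu> = (r * s) *\<^sub>R \<mu>"
    by transfer simp
  show "1 *\<^sub>R \<mu> = \<mu>"
    by transfer simp
  show "dist \<mu> \<nu> = norm (\<mu> - \<nu>)"
    by (rule dist_cabv_def)
  show "sgn \<mu> = inverse (norm \<mu>) *\<^sub>R \<mu>"
    by (rule sgn_cabv_def)
  show "(uniformity :: (('a, 'b) cabv \<times> ('a, 'b) cabv) filter) =
      (INF e\<in>{0 <..}. principal {(\<mu>, \<nu>). dist \<mu> \<nu> < e})"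
    by (rule uniformity_cabv_def)
  show "open S = (\<forall>\<mu>\<in>S. \<forall>\<^sub>F (\<mu>', \<nu>) in uniformity. \<mu>' = \<mu> \<longrightarrow> \<nu> \<in> S)"
    for S :: "('a, 'b) cabv set"
    by (rule open_cabv_def)
  show "norm \<mu> = 0 \<longleftrightarrow> \<mu> = 0"
  proof
    assume "norm \<mu> = 0"
    then show "\<mu> = 0"
    proof transfer
      fix \<mu> :: "'a set \<Rightarrow> 'b" assume \<mu>: "is_cabv \<mu>" "total_variation \<mu> = 0"
      show "\<mu> = (\<lambda>B. 0)"
      proof
        fix B show "\<mu> B = 0"
          using norm_le_total_variation[OF \<mu>(1), of B] \<mu>(2) by simp
      qed
    qed
  next
    have "total_variation (\<lambda>B :: 'a set. 0 :: 'b) \<le> 0"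
      by (rule total_variation_le) simp
    then have "total_variation (\<lambda>B :: 'a set. 0 :: 'b) = 0"
      using total_variation_nonneg[OF is_cabv_zero] by (rule antisym)
    moreover assume "\<mu> = 0"
    ultimately show "norm \<mu> = 0"
      by (simp add: norm_cabv.rep_eq zero_cabv.rep_eq)
  qed
  show "norm (\<mu> + \<nu>) \<le> norm \<mu> + norm \<nu>"
    by transfer (rule is_cabv_add)
  show "norm (r *\<^sub>R \<mu>) = \<bar>r\<bar> * norm \<mu>"
  proof (transfer, rule antisym)
    have le: "total_variation (\<lambda>B. r *\<^sub>R \<mu> B) \<le> \<bar>r\<bar> * total_variation \<mu>"
      if "is_cabv \<mu>" for r and \<mu> :: "'a set \<Rightarrow> 'b"
    proof (rule total_variation_le)
      fix P :: "'a set set" assume "P \<in> borel_partitions"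
      from mult_left_mono[OF partition_sum_le_total_variation[OF that this] abs_ge_zero[of r]]
      show "(\<Sum>B\<in>P. norm (r *\<^sub>R \<mu> B)) \<le> \<bar>r\<bar> * total_variation \<mu>"
        by (simp add: sum_distrib_left)
    qed
    fix r and \<mu> :: "'a set \<Rightarrow> 'b" assume \<mu>: "is_cabv \<mu>"
    show "total_variation (\<lambda>B. r *\<^sub>R \<mu> B) \<le> \<bar>r\<bar> * total_variation \<mu>"
      by (rule le[OF \<mu>])
    have r\<mu>: "is_cabv (\<lambda>B. r *\<^sub>R \<mu> B)"
      by (rule is_cabv_compose[OF \<mu>]) (rule bounded_linear_scaleR_right)
    show "\<bar>r\<bar> * total_variation \<mu> \<le> total_variation (\<lambda>B. r *\<^sub>R \<mu> B)"
    proof (cases "r = 0")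
      case True
      then show ?thesis using total_variation_nonneg[OF r\<mu>] by simp
    next
      case False
      then show ?thesis using le[OF r\<mu>, of "inverse r"] by (simp add: field_simps)
    qed
  qed
qed

end

text \<open>The image \<open>h(\<mu>)\<close> is defined for Borel measurable \<open>h\<close>, in particular for every continuous
  \<open>h\<close>; otherwise it is \<open>0\<close> by convention.\<close>

lift_definition image_cabv ::
    "('t::topological_space \<Rightarrow> 't) \<Rightarrow> ('t, 'x::real_normed_vector) cabv \<Rightarrow> ('t, 'x) cabv"
  is "\<lambda>h \<mu> B. if h \<in> borel \<rightarrow>\<^sub>M borel \<and> B \<in> sets borel then \<mu> (h -` B) else 0"
proof -
  fix h :: "'t \<Rightarrow> 't" and \<mu> :: "'t set \<Rightarrow> 'x" assume \<mu>: "is_cabv \<mu>"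
  show "is_cabv (\<lambda>B. if h \<in> borel \<rightarrow>\<^sub>M borel \<and> B \<in> sets borel then \<mu> (h -` B) else 0)"
  proof (cases "h \<in> borel \<rightarrow>\<^sub>M borel")
    case True
    then show ?thesis
      using is_cabv_image[OF \<mu> True] by (simp only: simp_thms)
  next
    case False
    then show ?thesis
      by (simp only: simp_thms if_False is_cabv_zero)
  qed
qed

lift_definition op_cabv ::
    "('x::real_normed_vector \<Rightarrow>\<^sub>L 'x) \<Rightarrow> ('t::topological_space, 'x) cabv \<Rightarrow> ('t, 'x) cabv"
  is "\<lambda>R \<mu> B. blinfun_apply R (\<mu> B)"
  by (rule is_cabv_compose[OF _ blinfun.bounded_linear_right])

lemma op_image_cabv:
  assumes "continuous_on UNIV h" "B \<in> sets borel"
  shows "measure_of_cabv (op_cabv R (image_cabv h \<mu>)) B = R (measure_of_cabv \<mu> (h -` B))"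
  by (simp add: op_cabv.rep_eq image_cabv.rep_eq assms(2) borel_measurable_continuous_onI[OF assms(1)])

end

theory Submission
  imports Defs
begin

text \<open>
  The result is Banach's fixed point theorem. The pushforward \<open>\<mu> \<mapsto> \<omega>(\<mu>)\<close> does not increase the
  variational norm, because the preimages under \<open>\<omega>\<close> of a Borel partition form again a Borel
  partition (\<open>norm_image_cabv_le\<close>). An operator \<open>R\<close> increases the norm at most by the factor
  \<open>\<parallel>R\<parallel>\<close> (\<open>norm_op_cabv_le\<close>). Hence the linear map \<open>H\<close> has norm at most \<open>e = \<Sum> \<parallel>R\<^sub>i\<parallel> < 1\<close>, and
  the translate \<open>H\<^sub>2\<close> is \<open>e\<close>-Lipschitz on the whole space.

  The other ingredient is that \<open>cabv(X)\<close> is complete when \<open>X\<close> is, so that closed sets of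
  measures are complete. A Cauchy sequence of measures is uniformly Cauchy on the subsets of
  \<open>T\<close>, since \<open>\<parallel>\<mu>(B)\<parallel> \<le> \<parallel>\<mu>\<parallel>\<close>. Its uniform limit is \<open>\<sigma>\<close>-additive by an exchange of
  limits and has finite variation because the norms along the sequence are bounded
  (\<open>is_cabv_uniform_limit\<close>). Convergence in the variational norm follows by letting one index of the
  Cauchy condition tend to infinity in the sum over each fixed partition.

  When \<open>\<mu>\<^sub>0 = 0\<close>, the measure \<open>0\<close> is fixed by \<open>H\<^sub>2\<close>. Fixed points are unique in the whole
  space, not only in \<open>A\<close>, so the fixed point that lies in \<open>A\<close> is \<open>0\<close>; this is why \<open>0 \<in> A\<close>.
\<close>

section \<open>Measures of bounded variation\<close>

lemma is_cabv_measure_of_cabv: "is_cabv (measure_of_cabv \<mu>)"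
  using measure_of_cabv[of \<mu>] by simp

lemma norm_measure_le: "norm (measure_of_cabv \<mu> B) \<le> norm \<mu>"
  by (simp add: norm_cabv.rep_eq norm_le_total_variation is_cabv_measure_of_cabv)

lemma partition_sum_le_norm:
  "P \<in> borel_partitions \<Longrightarrow> (\<Sum>B\<in>P. norm (measure_of_cabv \<mu> B)) \<le> norm \<mu>"
  by (simp add: norm_cabv.rep_eq partition_sum_le_total_variation is_cabv_measure_of_cabv)

lemma norm_cabv_le:
  assumes "\<And>P. P \<in> borel_partitions \<Longrightarrow> (\<Sum>B\<in>P. norm (measure_of_cabv \<mu> B)) \<le> c"
  shows "norm \<mu> \<le> c"
  by (simp add: norm_cabv.rep_eq total_variation_le assms)

text \<open>
  Pad the finite family with empty sets. Stating this for an initial segment of an infinite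
  family identifies the partial sums of the series in \<open>\<sigma>\<close>-additivity as values of \<open>\<mu>\<close>.
\<close>

lemma is_cabv_finitely_additive:
  fixes B :: "nat \<Rightarrow> 't::topological_space set"
  assumes "is_cabv \<mu>" "range B \<subseteq> sets borel" "disjoint_family B"
  shows "(\<Sum>k<K. \<mu> (B k)) = \<mu> (\<Union>k<K. B k)"
proof -
  define C where "C k = (if k < K then B k else {})" for k
  have "range C \<subseteq> sets borel" "disjoint_family C"
    using assms(2,3) by (auto simp: C_def disjoint_family_on_def)
  then have "(\<lambda>k. \<mu> (C k)) sums \<mu> (\<Union>k. C k)"
    by (rule is_cabv_sums[OF assms(1)])
  moreover have "(\<lambda>k. \<mu> (C k)) sums (\<Sum>k<K. \<mu> (C k))"
    by (rule sums_finite) (auto simp: C_def is_cabv_empty[OF assms(1)])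
  moreover have "(\<Union>k. C k) = (\<Union>k<K. B k)"
    by (auto simp: C_def split: if_splits)
  ultimately show ?thesis
    using sums_unique2[of "\<lambda>k. \<mu> (C k)"] by (simp add: C_def)
qed

section \<open>Completeness\<close>

text \<open>
  For disjoint \<open>B\<^sub>k\<close>, finite additivity passes to the limit \<open>\<mu>\<close> pointwise, so the partial sums
  of \<open>\<Sum> \<mu>(B\<^sub>k)\<close> are the values \<open>\<mu>(\<Union>k<K. B\<^sub>k)\<close>. These are uniform limits in \<open>K\<close> of
  \<open>f\<^sub>n(\<Union>k<K. B\<^sub>k)\<close>, and therefore the limits over \<open>n\<close> and \<open>K\<close> may be exchanged.
\<close>

lemma is_cabv_uniform_limit:
  fixes f :: "nat \<Rightarrow> 't::topological_space set \<Rightarrow> 'x::real_normed_vector"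
  assumes f: "\<And>n. is_cabv (f n)"
    and lim: "uniform_limit UNIV f \<mu> sequentially"
    and bound: "\<And>n. total_variation (f n) \<le> c"
  shows "is_cabv \<mu>"
proof -
  have pointwise: "(\<lambda>n. f n B) \<longlonglongrightarrow> \<mu> B" for B
    using tendsto_uniform_limitI[OF lim UNIV_I] .
  show ?thesis
  proof (rule is_cabvI)
    show "\<mu> B = 0" if "B \<notin> sets borel" for B
      using pointwise[of B] that by (simp add: is_cabv_outside[OF f] LIMSEQ_const_iff)
    fix P :: "'t set set" assume P: "P \<in> borel_partitions"
    have "(\<lambda>n. \<Sum>B\<in>P. norm (f n B)) \<longlonglongrightarrow> (\<Sum>B\<in>P. norm (\<mu> B))"
      by (intro tendsto_intros pointwise)
    then show "(\<Sum>B\<in>P. norm (\<mu> B)) \<le> c"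
      by (rule LIMSEQ_le_const2)
        (use order_trans[OF partition_sum_le_total_variation[OF f P] bound] in blast)
  next
    fix B :: "nat \<Rightarrow> 't set" assume B: "range B \<subseteq> sets borel" "disjoint_family B"
    have sum_\<mu>: "(\<Sum>k<K. \<mu> (B k)) = \<mu> (\<Union>k<K. B k)" for K
    proof (rule LIMSEQ_unique)
      show "(\<lambda>n. \<Sum>k<K. f n (B k)) \<longlonglongrightarrow> (\<Sum>k<K. \<mu> (B k))"
        by (intro tendsto_intros pointwise)
      show "(\<lambda>n. \<Sum>k<K. f n (B k)) \<longlonglongrightarrow> \<mu> (\<Union>k<K. B k)"
        using pointwise by (simp add: is_cabv_finitely_additive[OF f B])
    qed
    \<comment> \<open>Uniformity over all sets restricts to uniformity over the finite unions indexed by \<open>K\<close>.\<close>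
    have "uniform_limit UNIV (\<lambda>n K. f n (\<Union>k<K. B k)) (\<lambda>K. \<mu> (\<Union>k<K. B k)) sequentially"
      using lim by (auto simp: uniform_limit_iff elim!: eventually_mono)
    moreover have "\<forall>\<^sub>F n in sequentially.
        ((\<lambda>K. f n (\<Union>k<K. B k)) \<longlongrightarrow> f n (\<Union>k. B k)) (sequentially)"
      using is_cabv_sums[OF f B] by (simp add: sums_def is_cabv_finitely_additive[OF f B])
    ultimately have "(\<lambda>K. \<mu> (\<Union>k<K. B k)) \<longlonglongrightarrow> \<mu> (\<Union>k. B k)"
      using swap_uniform_limit'[OF _ pointwise, where S = UNIV] by simp
    then show "(\<lambda>k. \<mu> (B k)) sums \<mu> (\<Union>k. B k)"
      by (simp add: sums_def sum_\<mu>)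
  qed
qed

instance cabv :: (topological_space, banach) banach
proof
  fix X :: "nat \<Rightarrow> ('a, 'b) cabv" assume X: "Cauchy X"
  define f where "f n = measure_of_cabv (X n)" for n
  have diff: "norm (f m B - f n B) \<le> dist (X m) (X n)" for m n B
    using norm_measure_le[of "X m - X n" B] by (simp add: dist_norm f_def minus_cabv.rep_eq)
  have "uniformly_Cauchy_on UNIV f"
    unfolding uniformly_Cauchy_on_def
  proof (intro allI impI)
    fix r :: real assume "r > 0"
    from metric_CauchyD[OF X this] obtain N where
      "\<And>m n. m \<ge> N \<Longrightarrow> n \<ge> N \<Longrightarrow> dist (X m) (X n) < r"
      by blast
    then show "\<exists>N. \<forall>B\<in>UNIV. \<forall>m\<ge>N. \<forall>n\<ge>N. dist (f m B) (f n B) < r"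
      unfolding dist_norm[of "f _ _"] by (blast intro: le_less_trans[OF diff])
  qed
  then have "uniformly_convergent_on UNIV f"
    by (rule Cauchy_uniformly_convergent)
  then obtain \<mu> where lim: "uniform_limit UNIV f \<mu> sequentially"
    by (auto simp: uniformly_convergent_on_def)
  obtain c where c: "\<And>n. norm (X n) \<le> c"
    using Cauchy_Bseq[OF X] by (auto simp: Bseq_def)
  have \<mu>: "is_cabv \<mu>"
    by (rule is_cabv_uniform_limit[OF _ lim, of c])
      (use c in \<open>simp_all add: f_def is_cabv_measure_of_cabv norm_cabv.rep_eq\<close>)
  then have rep: "measure_of_cabv (Cabv \<mu>) = \<mu>"
    by (simp add: Cabv_inverse)
  \<comment> \<open>Uniform convergence on sets does not bound the variation, which is controlled through the
    Cauchy condition on each partition separately.\<close>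
  have "X \<longlonglongrightarrow> Cabv \<mu>"
  proof (rule metric_LIMSEQ_I)
    fix r :: real assume "r > 0"
    then obtain N where N: "\<And>m n. m \<ge> N \<Longrightarrow> n \<ge> N \<Longrightarrow> dist (X m) (X n) < r / 2"
      using metric_CauchyD[OF X, of "r / 2"] by auto
    have "dist (X n) (Cabv \<mu>) < r" if n: "n \<ge> N" for n
    proof -
      have "norm (X n - Cabv \<mu>) \<le> r / 2"
      proof (rule norm_cabv_le)
        fix P :: "'a set set" assume P: "P \<in> borel_partitions"
        have "(\<lambda>m. \<Sum>B\<in>P. norm (f n B - f m B)) \<longlonglongrightarrow> (\<Sum>B\<in>P. norm (f n B - \<mu> B))"
          by (intro tendsto_intros tendsto_uniform_limitI[OF lim]) simp
        moreover have "(\<Sum>B\<in>P. norm (f n B - f m B)) \<le> r / 2" if "m \<ge> N" for m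
          using partition_sum_le_norm[OF P, of "X n - X m"] N[OF n that]
          by (simp add: dist_norm f_def minus_cabv.rep_eq)
        ultimately have "(\<Sum>B\<in>P. norm (f n B - \<mu> B)) \<le> r / 2"
          by (blast intro: LIMSEQ_le_const2)
        then show "(\<Sum>B\<in>P. norm (measure_of_cabv (X n - Cabv \<mu>) B)) \<le> r / 2"
          by (simp add: f_def minus_cabv.rep_eq rep)
      qed
      then show ?thesis
        using \<open>r > 0\<close> by (simp add: dist_norm)
    qed
    then show "\<exists>N. \<forall>n\<ge>N. dist (X n) (Cabv \<mu>) < r"
      by blast
  qed
  then show "convergent X"
    by (rule convergentI)
qed

section \<open>Norm bounds for images and operators\<close>

text \<open>The empty set is removed since the blocks of a partition are nonempty, while \<open>h\<close> may miss
  some block entirely.\<close>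

lemma vimage_borel_partition:
  fixes h :: "'s::topological_space \<Rightarrow> 't::topological_space"
  assumes P: "P \<in> borel_partitions" and h: "h \<in> borel \<rightarrow>\<^sub>M borel"
  shows "vimage h ` P - {{}} \<in> borel_partitions"
proof -
  have "vimage h ` P \<subseteq> sets borel"
    using P measurable_sets[OF h] by (auto simp: borel_partitions_def)
  then show ?thesis
    using P partition_on_vimage[of UNIV P h] by (auto simp: borel_partitions_def)
qed

text \<open>
  Each partition sum of \<open>h(\<mu>)\<close> is a partition sum of \<open>\<mu>\<close> for the preimage partition. Distinct
  blocks can share a preimage only if it is empty, and then they contribute \<open>0\<close>.
\<close>

lemma norm_image_cabv_le:
  fixes h :: "'t::topological_space \<Rightarrow> 't"
  shows "norm (image_cabv h \<mu>) \<le> norm \<mu>"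
proof (cases "h \<in> borel \<rightarrow>\<^sub>M borel")
  case h: True
  let ?m = "measure_of_cabv \<mu>"
  show ?thesis
  proof (rule norm_cabv_le)
    fix P :: "'t set set" assume P: "P \<in> borel_partitions"
    then have fin: "finite P" and sub: "P \<subseteq> sets borel" and disj: "disjoint P"
      by (auto simp: borel_partitions_def partition_on_def)
    have "(\<Sum>B\<in>P. norm (measure_of_cabv (image_cabv h \<mu>) B)) = (\<Sum>B\<in>P. norm (?m (h -` B)))"
      using sub h by (intro sum.cong) (auto simp: image_cabv.rep_eq)
    also have "\<dots> = (\<Sum>C\<in>vimage h ` P. norm (?m C))"
    proof (rule sum.reindex_nontrivial[symmetric, unfolded comp_def])
      fix B C assume BC: "B \<in> P" "C \<in> P" "B \<noteq> C" "h -` B = h -` C"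
      then have "B \<inter> C = {}"
        using disj by (auto simp: disjoint_def)
      then have "h -` B = {}"
        using BC(4) by auto
      then show "norm (?m (h -` B)) = 0"
        by (simp add: is_cabv_empty[OF is_cabv_measure_of_cabv])
    qed (rule fin)
    also have "\<dots> = (\<Sum>C\<in>vimage h ` P - {{}}. norm (?m C))"
      using fin by (intro sum.mono_neutral_right)
        (auto simp: is_cabv_empty[OF is_cabv_measure_of_cabv])
    also have "\<dots> \<le> norm \<mu>"
      by (rule partition_sum_le_norm[OF vimage_borel_partition[OF P h]])
    finally show "(\<Sum>B\<in>P. norm (measure_of_cabv (image_cabv h \<mu>) B)) \<le> norm \<mu>" .
  qed
next
  case False
  then have "image_cabv h \<mu> = 0"
    by (intro cabv_eqI) (simp add: image_cabv.rep_eq zero_cabv.rep_eq)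
  then show ?thesis
    by simp
qed

lemma norm_op_cabv_le: "norm (op_cabv R \<mu>) \<le> norm R * norm \<mu>"
proof (rule norm_cabv_le)
  fix P :: "'a set set" assume P: "P \<in> borel_partitions"
  have "(\<Sum>B\<in>P. norm (measure_of_cabv (op_cabv R \<mu>) B))
      \<le> (\<Sum>B\<in>P. norm R * norm (measure_of_cabv \<mu> B))"
    unfolding op_cabv.rep_eq by (rule sum_mono) (rule norm_blinfun)
  also have "\<dots> \<le> norm R * norm \<mu>"
    unfolding sum_distrib_left[symmetric]
    by (rule mult_left_mono[OF partition_sum_le_norm[OF P] norm_ge_zero])
  finally show "(\<Sum>B\<in>P. norm (measure_of_cabv (op_cabv R \<mu>) B)) \<le> norm R * norm \<mu>" .
qed

lemma op_image_cabv_diff: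
  "op_cabv R (image_cabv h \<mu>) - op_cabv R (image_cabv h \<nu>) = op_cabv R (image_cabv h (\<mu> - \<nu>))"
  by (rule cabv_eqI)
    (simp add: op_cabv.rep_eq image_cabv.rep_eq minus_cabv.rep_eq blinfun.bilinear_simps)

lemma op_image_cabv_zero: "op_cabv R (image_cabv h 0) = 0"
  using op_image_cabv_diff[of R h 0 0] by simp

lemma norm_op_image_cabv_le: "norm (op_cabv R (image_cabv h \<mu>)) \<le> norm R * norm \<mu>"
  using norm_op_cabv_le norm_image_cabv_le
  by (rule order_trans[OF _ mult_left_mono]) simp

section \<open>Contractions\<close>

lemma lipschitz_const_le: "L-lipschitz_on A f \<Longrightarrow> lipschitz_const A f \<le> L"
  unfolding lipschitz_const_def
  by (rule cInf_lower) (auto intro!: bdd_belowI[where m = 0] dest: lipschitz_on_nonneg)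

theorem theorem2p2p3:
  fixes scale :: "'k::real_normed_field \<Rightarrow> 'x::banach \<Rightarrow> 'x"
    and M :: nat
    and \<omega> :: "nat \<Rightarrow> 't::metric_space \<Rightarrow> 't"
    and R :: "nat \<Rightarrow> 'x \<Rightarrow>\<^sub>L 'x"
    and H H\<^sub>2 :: "('t, 'x) cabv \<Rightarrow> ('t, 'x) cabv"
    and \<mu>\<^sub>0 :: "('t, 'x) cabv"
    and e :: real
  assumes "normed_space_over scale" and "\<exists>x::'x. x \<noteq> 0"
    and "compact (UNIV :: 't set)" and "\<exists>s t :: 't. s \<noteq> t"
    and "1 \<le> M"
    and "\<And>i. i \<in> {1..M} \<Longrightarrow> \<exists>L. L-lipschitz_on UNIV (\<omega> i)"
    and "\<And>i c x. i \<in> {1..M} \<Longrightarrow> R i (scale c x) = scale c (R i x)"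
    and "H = (\<lambda>\<mu>. \<Sum>i=1..M. op_cabv (R i) (image_cabv (\<omega> i) \<mu>))"
    and "e = (\<Sum>i=1..M. norm (R i))" and "e < 1"
    and "H\<^sub>2 = (\<lambda>\<mu>. H \<mu> + \<mu>\<^sub>0)"
  shows "(\<forall>A. closed_invariant H\<^sub>2 A \<longrightarrow>
             contraction_on A H\<^sub>2 \<and> lipschitz_const A H\<^sub>2 \<le> e \<and>
             (\<mu>\<^sub>0 = 0 \<longrightarrow> 0 \<in> A) \<and>
             (\<exists>!\<mu>. \<mu> \<in> A \<and> H\<^sub>2 \<mu> = \<mu>) \<and>
             (\<mu>\<^sub>0 = 0 \<longrightarrow> (\<forall>\<mu>\<in>A. H\<^sub>2 \<mu> = \<mu> \<longrightarrow> \<mu> = 0))) \<and>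
         closed_invariant H\<^sub>2 UNIV \<and>
         (\<forall>a. 0 < a \<longrightarrow> norm \<mu>\<^sub>0 + a * (\<Sum>i=1..M. norm (R i)) \<le> a \<longrightarrow>
             closed_invariant H\<^sub>2 {\<mu>. norm \<mu> \<le> a})"
proof -
  note H = assms(8) and e = assms(9) and e_less = assms(10) and H\<^sub>2 = assms(11)
  have e_nonneg: "0 \<le> e"
    unfolding e by (simp add: sum_nonneg)
  have norm_H: "norm (H \<mu>) \<le> e * norm \<mu>" for \<mu>
    unfolding H e sum_distrib_right by (intro sum_norm_le norm_op_image_cabv_le)
  have "H \<mu> - H \<nu> = H (\<mu> - \<nu>)" for \<mu> \<nu>
    by (simp add: H sum_subtractf[symmetric] op_image_cabv_diff)
  then have dist_le: "dist (H\<^sub>2 \<mu>) (H\<^sub>2 \<nu>) \<le> e * dist \<mu> \<nu>" for \<mu> \<nu>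
    using norm_H[of "\<mu> - \<nu>"] by (simp add: H\<^sub>2 dist_norm)
  then have lipschitz: "e-lipschitz_on A H\<^sub>2" for A
    using e_nonneg by (rule lipschitz_onI)
  have fixed_zero: "\<mu> = 0" if "\<mu>\<^sub>0 = 0" "H\<^sub>2 \<mu> = \<mu>" for \<mu>
  proof -
    have "H\<^sub>2 0 = 0"
      using that(1) by (simp add: H\<^sub>2 H op_image_cabv_zero)
    then show ?thesis
      using Banach_fix[OF complete_UNIV UNIV_not_empty e_nonneg e_less subset_UNIV dist_le] that(2)
      by blast
  qed
  have "contraction_on A H\<^sub>2 \<and> lipschitz_const A H\<^sub>2 \<le> e \<and>
      (\<mu>\<^sub>0 = 0 \<longrightarrow> 0 \<in> A) \<and> (\<exists>!\<mu>. \<mu> \<in> A \<and> H\<^sub>2 \<mu> = \<mu>)"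
    if "closed_invariant H\<^sub>2 A" for A
  proof -
    have A: "A \<noteq> {}" "complete A" "H\<^sub>2 ` A \<subseteq> A"
      using that by (auto simp: closed_invariant_def complete_eq_closed)
    have le: "lipschitz_const A H\<^sub>2 \<le> e"
      by (rule lipschitz_const_le[OF lipschitz])
    have "\<exists>!\<mu>. \<mu> \<in> A \<and> H\<^sub>2 \<mu> = \<mu>"
      using Banach_fix[OF A(2,1) e_nonneg e_less A(3) dist_le] .
    then show ?thesis
      using le e_less A(3) lipschitz fixed_zero by (auto simp: contraction_on_def)
  qed
  moreover have "closed_invariant H\<^sub>2 UNIV"
    by (simp add: closed_invariant_def)
  moreover have "closed_invariant H\<^sub>2 {\<mu>. norm \<mu> \<le> a}"
    if "0 < a" and le: "norm \<mu>\<^sub>0 + a * (\<Sum>i=1..M. norm (R i)) \<le> a" for a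
  proof -
    have "norm (H\<^sub>2 \<mu>) \<le> a" if "norm \<mu> \<le> a" for \<mu>
    proof -
      have "norm (H\<^sub>2 \<mu>) \<le> e * norm \<mu> + norm \<mu>\<^sub>0"
        unfolding H\<^sub>2 by (intro norm_triangle_le add_right_mono norm_H)
      also have "\<dots> \<le> a"
        using mult_left_mono[OF that e_nonneg] le by (simp add: e mult.commute)
      finally show ?thesis .
    qed
    moreover have "closed {\<mu> :: ('t, 'x) cabv. norm \<mu> \<le> a}"
      by (intro closed_Collect_le continuous_intros)
    moreover have "(0 :: ('t, 'x) cabv) \<in> {\<mu>. norm \<mu> \<le> a}"
      using \<open>0 < a\<close> by simp
    ultimately show ?thesis
      unfolding closed_invariant_def by blast
  qed
  ultimately show ?thesis
    using fixed_zero by blast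
qed

end
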